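(* Let $X$ and $K$ be any two simplicial sets. If $X$ is non-singular, then the simplicial mapping set $X^K$ is non-singular.
   Context: For an $n$-simplex $x\in X_n$ of a simplicial set $X$, its representing map is the simplicial map $\bar x\colon \Delta[n]\to X$ corresponding to $x$ under the Yoneda lemma. A simplicial set $X$ is non-singular if for each $n \ge 0$ and each non-degenerate simplex $x\in X_n$ the representing map $\bar x\colon\Delta[n]\to X$ is degreewise injective. For simplicial sets $X$ and $K$, the simplicial mapping set $X^K$ is the simplicial set whose $n$-simplices are the simplicial maps $\Delta[n]\times K\to X$, where an operator (order-preserving function) $\alpha\colon[m]\to[n]$ acts by precomposition with $\alpha\times 1\colon\Delta[m]\times K\to\Delta[n]\times K$. *)

theory Defs
  imports "HOL-Library.FuncSet"
begin

text \<open>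
  The ordinal \<open>[n]\<close> is \<open>{..n}\<close>. An operator \<open>[m] \<rightarrow> [n]\<close> is extensional on \<open>{..m}\<close>, so
  that equality in HOL is equality of operators; the identity is \<open>restrict id {..m}\<close> and
  the composite of \<open>\<beta> : [k] \<rightarrow> [m]\<close> and \<open>\<alpha> : [m] \<rightarrow> [n]\<close> is \<open>compose {..k} \<alpha> \<beta>\<close>.
\<close>

definition operators :: "nat \<Rightarrow> nat \<Rightarrow> (nat \<Rightarrow> nat) set" where
  "operators m n = {\<alpha> \<in> {..m} \<rightarrow>\<^sub>E {..n}. mono_on {..m} \<alpha>}"

text \<open>
  \<open>act X m n \<alpha>\<close> is the function \<open>X\<^sub>n \<rightarrow> X\<^sub>m\<close> induced by \<open>\<alpha> : [m] \<rightarrow> [n]\<close>. It is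
  unconstrained outside \<open>X\<^sub>n\<close>, and the sets \<open>X\<^sub>n\<close> need not be disjoint for distinct \<open>n\<close>.
\<close>

record 'a sset =
  simplices :: "nat \<Rightarrow> 'a set"
  act :: "nat \<Rightarrow> nat \<Rightarrow> (nat \<Rightarrow> nat) \<Rightarrow> 'a \<Rightarrow> 'a"

locale simplicial_set =
  fixes X :: "'a sset"
  assumes act_closed:
      "\<alpha> \<in> operators m n \<Longrightarrow> x \<in> simplices X n \<Longrightarrow> act X m n \<alpha> x \<in> simplices X m"
    and act_id: "x \<in> simplices X n \<Longrightarrow> act X n n (restrict id {..n}) x = x"
    and act_comp: "\<beta> \<in> operators k m \<Longrightarrow> \<alpha> \<in> operators m n \<Longrightarrow> x \<in> simplices X n \<Longrightarrow>
      act X k n (compose {..k} \<alpha> \<beta>) x = act X k m \<beta> (act X m n \<alpha> x)"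

text \<open>Simplicial maps are extensional in each degree, again to make HOL equality the right one.\<close>

definition simplicial_maps :: "'a sset \<Rightarrow> 'b sset \<Rightarrow> (nat \<Rightarrow> 'a \<Rightarrow> 'b) set" where
  "simplicial_maps X Y = {f. (\<forall>n. f n \<in> simplices X n \<rightarrow>\<^sub>E simplices Y n) \<and>
     (\<forall>m n. \<forall>\<alpha>\<in>operators m n. \<forall>x\<in>simplices X n. f m (act X m n \<alpha> x) = act Y m n \<alpha> (f n x))}"

definition standard_simplex :: "nat \<Rightarrow> (nat \<Rightarrow> nat) sset" where
  "standard_simplex n =
     \<lparr>simplices = (\<lambda>k. operators k n), act = (\<lambda>j k \<beta> \<gamma>. compose {..j} \<gamma> \<beta>)\<rparr>"

definition product_sset :: "'a sset \<Rightarrow> 'b sset \<Rightarrow> ('a \<times> 'b) sset" where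
  "product_sset X Y =
     \<lparr>simplices = (\<lambda>n. simplices X n \<times> simplices Y n),
      act = (\<lambda>m n \<alpha>. map_prod (act X m n \<alpha>) (act Y m n \<alpha>))\<rparr>"

text \<open>The lemma \<open>yoneda\<close> below characterises this map.\<close>

definition representing_map :: "'a sset \<Rightarrow> nat \<Rightarrow> 'a \<Rightarrow> nat \<Rightarrow> (nat \<Rightarrow> nat) \<Rightarrow> 'a" where
  "representing_map X n x = (\<lambda>k. \<lambda>\<alpha>\<in>operators k n. act X k n \<alpha> x)"

definition degenerate :: "'a sset \<Rightarrow> nat \<Rightarrow> 'a \<Rightarrow> bool" where
  "degenerate X n x \<longleftrightarrow>
     (\<exists>m<n. \<exists>\<alpha>\<in>operators n m. \<alpha> ` {..n} = {..m} \<and> (\<exists>y\<in>simplices X m. x = act X n m \<alpha> y))"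

locale nonsingular_simplicial_set = simplicial_set +
  assumes nonsingular: "x \<in> simplices X n \<Longrightarrow> \<not> degenerate X n x \<Longrightarrow>
    inj_on (representing_map X n x k) (simplices (standard_simplex n) k)"

text \<open>
  In degree \<open>k\<close>, the map \<open>\<alpha> \<times> 1 : \<Delta>[m] \<times> K \<rightarrow> \<Delta>[n] \<times> K\<close> sends \<open>(\<beta>, y)\<close> to \<open>(\<alpha> \<circ> \<beta>, y)\<close>.
\<close>

definition mapping_sset :: "'a sset \<Rightarrow> 'b sset \<Rightarrow> (nat \<Rightarrow> (nat \<Rightarrow> nat) \<times> 'b \<Rightarrow> 'a) sset" where
  "mapping_sset X K =
     \<lparr>simplices = (\<lambda>n. simplicial_maps (product_sset (standard_simplex n) K) X),
      act = (\<lambda>m n \<alpha> f k. compose (simplices (product_sset (standard_simplex m) K) k)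
                            (f k) (map_prod (compose {..k} \<alpha>) id))\<rparr>"

lemma operators_id [simp]: "restrict id {..n} \<in> operators n n"
  by (auto simp: operators_def mono_on_def)

lemma operators_compose:
  assumes "\<beta> \<in> operators k m" "\<alpha> \<in> operators m n"
  shows "compose {..k} \<alpha> \<beta> \<in> operators k n"
  using assms unfolding operators_def mono_on_def compose_def PiE_iff
  by (auto simp: Pi_iff)

lemma operators_compose_id:
  assumes "\<alpha> \<in> operators m n"
  shows "compose {..m} \<alpha> (restrict id {..m}) = \<alpha>" "compose {..m} (restrict id {..n}) \<alpha> = \<alpha>"
  using assms by (auto simp: operators_def compose_def fun_eq_iff PiE_iff extensional_def)

lemma operators_compose_assoc:
  assumes "\<gamma> \<in> operators j k"
  shows "compose {..j} (compose {..k} \<alpha> \<beta>) \<gamma> = compose {..j} \<alpha> (compose {..j} \<beta> \<gamma>)"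
  using assms by (auto simp: operators_def compose_def fun_eq_iff PiE_iff)

lemma simplicial_set_standard_simplex: "simplicial_set (standard_simplex n)"
  by unfold_locales
    (auto simp: standard_simplex_def operators_compose operators_compose_id operators_compose_assoc)

lemma simplicial_set_product:
  assumes "simplicial_set X" "simplicial_set Y"
  shows "simplicial_set (product_sset X Y)"
proof -
  interpret X: simplicial_set X by fact
  interpret Y: simplicial_set Y by fact
  show ?thesis
    by unfold_locales
      (auto simp: product_sset_def X.act_closed Y.act_closed X.act_id Y.act_id X.act_comp Y.act_comp)
qed

lemma (in simplicial_set) yoneda:
  assumes "x \<in> simplices X n"
  shows "representing_map X n x \<in> simplicial_maps (standard_simplex n) X"
    and "representing_map X n x n (restrict id {..n}) = x"
    and "f \<in> simplicial_maps (standard_simplex n) X \<Longrightarrow> f n (restrict id {..n}) = x \<Longrightarrow>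
      f = representing_map X n x"
proof -
  show "representing_map X n x \<in> simplicial_maps (standard_simplex n) X"
    using assms
    by (auto simp: simplicial_maps_def representing_map_def standard_simplex_def act_closed
        operators_compose act_comp)
  show "representing_map X n x n (restrict id {..n}) = x"
    unfolding representing_map_def restrict_apply'[OF operators_id] by (rule act_id[OF assms])
  assume f: "f \<in> simplicial_maps (standard_simplex n) X" and x: "f n (restrict id {..n}) = x"
  show "f = representing_map X n x"
  proof (intro ext)
    fix k \<alpha>
    show "f k \<alpha> = representing_map X n x k \<alpha>"
    proof (cases "\<alpha> \<in> operators k n")
      case True
      have "f k (act (standard_simplex n) k n \<alpha> (restrict id {..n})) =
          act X k n \<alpha> (f n (restrict id {..n}))"
        using f True operators_id[of n]
        unfolding simplicial_maps_def standard_simplex_def by simp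
      then show ?thesis
        using True x operators_compose_id(2)[OF True]
        by (simp add: standard_simplex_def representing_map_def)
    next
      case False
      have "f k \<in> extensional (operators k n)"
        using f by (auto simp: simplicial_maps_def standard_simplex_def PiE_iff)
      then show ?thesis
        using False by (simp add: representing_map_def extensional_def)
    qed
  qed
qed

lemma simplicial_set_mapping_sset:
  assumes "simplicial_set X" "simplicial_set K"
  shows "simplicial_set (mapping_sset X K)"
proof -
  interpret X: simplicial_set X by fact
  interpret K: simplicial_set K by fact
  show ?thesis
  proof
    fix \<alpha> m n f assume \<alpha>: "\<alpha> \<in> operators m n" and f: "f \<in> simplices (mapping_sset X K) n"
    have f_in: "f k (\<gamma>, y) \<in> simplices X k" if "\<gamma> \<in> operators k n" "y \<in> simplices K k" for k \<gamma> y
      using f that by (auto simp: mapping_sset_def simplicial_maps_def product_sset_def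
          standard_simplex_def PiE_iff)
    have f_nat: "f j (compose {..j} \<gamma> \<beta>, act K j k \<beta> y) = act X j k \<beta> (f k (\<gamma>, y))"
      if "\<beta> \<in> operators j k" "\<gamma> \<in> operators k n" "y \<in> simplices K k" for j k \<beta> \<gamma> y
      using f that by (auto simp: mapping_sset_def simplicial_maps_def product_sset_def
          standard_simplex_def)
    show "act (mapping_sset X K) m n \<alpha> f \<in> simplices (mapping_sset X K) m"
      using \<alpha> by (auto simp: mapping_sset_def simplicial_maps_def product_sset_def
          standard_simplex_def compose_eq operators_compose K.act_closed f_in
          operators_compose_assoc[symmetric] f_nat)
        (auto simp: compose_def split: if_splits)
  next
    fix f n assume f: "f \<in> simplices (mapping_sset X K) n"
    have "act (mapping_sset X K) n n (restrict id {..n}) f k z = f k z" for k z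
    proof (cases "z \<in> operators k n \<times> simplices K k")
      case True
      then show ?thesis
        by (auto simp: mapping_sset_def product_sset_def standard_simplex_def compose_eq
            operators_compose_id)
    next
      case False
      then show ?thesis
        using f by (cases z) (auto simp: mapping_sset_def simplicial_maps_def product_sset_def
            standard_simplex_def compose_def PiE_iff extensional_def)
    qed
    then show "act (mapping_sset X K) n n (restrict id {..n}) f = f" by blast
  next
    fix \<beta> k m \<alpha> n f
    assume \<beta>: "\<beta> \<in> operators k m" and \<alpha>: "\<alpha> \<in> operators m n"
      and f: "f \<in> simplices (mapping_sset X K) n"
    have "act (mapping_sset X K) k n (compose {..k} \<alpha> \<beta>) f j z =
        act (mapping_sset X K) k m \<beta> (act (mapping_sset X K) m n \<alpha> f) j z" for j z
    proof (cases "z \<in> operators j k \<times> simplices K j")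
      case True
      then show ?thesis
        using \<beta> by (auto simp: mapping_sset_def product_sset_def standard_simplex_def compose_eq
            operators_compose operators_compose_assoc)
    next
      case False
      then show ?thesis
        by (auto simp: mapping_sset_def product_sset_def standard_simplex_def compose_def)
    qed
    then show "act (mapping_sset X K) k n (compose {..k} \<alpha> \<beta>) f =
        act (mapping_sset X K) k m \<beta> (act (mapping_sset X K) m n \<alpha> f)"
      by blast
  qed
qed

end

theory Submission
  imports Defs
begin

text \<open>
  Let \<open>f : \<Delta>[n] \<times> K \<rightarrow> X\<close> be an \<open>n\<close>-simplex of the mapping set whose representing map identifies
  two distinct operators; it has to be shown that \<open>f\<close> is degenerate. Operators that differ do so
  at a vertex, so there are \<open>a < b \<le> n\<close> such that \<open>f (a, v) = f (b, v)\<close> for all vertices \<open>v\<close> of \<open>K\<close>,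
  and everything follows from these equations between vertices of \<open>X\<close>.

  What makes this possible is that in a non-singular simplicial set the coincidences between the
  vertices of a simplex determine those between its faces: write \<open>x = \<sigma>\<^sup>*y\<close> with \<open>y\<close>
  non-degenerate; as the vertices of \<open>y\<close> are distinct, the vertices \<open>i\<close> and \<open>j\<close> of \<open>x\<close> agree
  exactly if \<open>\<sigma> i = \<sigma> j\<close> (\<open>vertices_eq_iff_collapse\<close>). There are two consequences. If
  the vertices \<open>a\<close> and \<open>b\<close> of \<open>x\<close> agree, then so do all those between them, because \<open>\<sigma>\<close> is
  monotone. And if \<open>\<alpha>\<close> and \<open>\<beta>\<close> select equal vertices of \<open>x\<close> in each position, then
  \<open>\<sigma> \<circ> \<alpha> = \<sigma> \<circ> \<beta>\<close>, hence \<open>\<alpha>\<^sup>*x = \<beta>\<^sup>*x\<close>.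

  By the first consequence, \<open>f (a, v) = f (a + 1, v)\<close> for all \<open>v\<close>. The second extends this to
  simplices of positive dimension: if \<open>\<alpha> \<le> \<beta> : [k] \<rightarrow> [n]\<close> agree on vertices after
  application of \<open>f\<close>, then the standard decomposition of the prism between \<open>(\<alpha>, y)\<close> and \<open>(\<beta>, y)\<close>
  into \<open>(k + 1)\<close>-simplices changes one vertex at a time, and each step identifies two consecutive
  faces of a simplex of \<open>X\<close> that select equal vertices (\<open>prism_eq\<close>). Taking \<open>\<alpha>\<close> to be the composite of
  \<open>\<beta>\<close> with the map \<open>[n] \<rightarrow> [n]\<close> that sends \<open>a + 1\<close> to \<open>a\<close> and fixes all else shows that \<open>f\<close>
  factors through the degeneracy operator that collapses \<open>a\<close> and \<open>a + 1\<close>.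
\<close>

section \<open>Vertices of simplices in a non-singular simplicial set\<close>

definition vertex_op :: "nat \<Rightarrow> nat \<Rightarrow> nat" where
  "vertex_op i = (\<lambda>_\<in>{..0}. i)"

lemma vertex_op_in: "i \<le> n \<Longrightarrow> vertex_op i \<in> operators 0 n"
  by (auto simp: vertex_op_def operators_def mono_on_def)

lemma compose_vertex_op: "compose {0} \<alpha> (vertex_op i) = vertex_op (\<alpha> i)"
  by (auto simp: vertex_op_def compose_def fun_eq_iff)

lemma vertex_op_eq_iff: "vertex_op i = vertex_op j \<longleftrightarrow> i = j"
  by (auto simp: vertex_op_def fun_eq_iff)

lemma operators_le: "\<alpha> \<in> operators m n \<Longrightarrow> i \<le> m \<Longrightarrow> \<alpha> i \<le> n"
  by (auto simp: operators_def)

lemma operators_mono: "\<alpha> \<in> operators m n \<Longrightarrow> i \<le> j \<Longrightarrow> j \<le> m \<Longrightarrow> \<alpha> i \<le> \<alpha> j"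
  by (auto simp: operators_def mono_on_def)

lemma operators_eqI:
  assumes "\<alpha> \<in> operators m n" "\<beta> \<in> operators m n" "\<And>i. i \<le> m \<Longrightarrow> \<alpha> i = \<beta> i"
  shows "\<alpha> = \<beta>"
  using assms by (intro extensionalityI[of _ "{..m}"]) (auto simp: operators_def PiE_iff)

lemma restrict_in_operators:
  assumes "\<And>i. i \<le> m \<Longrightarrow> h i \<le> n" "\<And>i j. i \<le> j \<Longrightarrow> j \<le> m \<Longrightarrow> h i \<le> h j"
  shows "restrict h {..m} \<in> operators m n"
  using assms by (auto simp: operators_def mono_on_def)

context simplicial_set
begin

text \<open>
  This is the existence half of the Eilenberg--Zilber lemma, by descent along the degree, except
  that \<open>\<sigma>\<close> is not asserted to be surjective.
\<close>

lemma nondegenerate_root: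
  assumes "x \<in> simplices X n"
  obtains m \<sigma> y where "\<sigma> \<in> operators n m" "y \<in> simplices X m" "\<not> degenerate X m y"
    "x = act X n m \<sigma> y"
proof -
  have "\<exists>m \<sigma> y. \<sigma> \<in> operators n m \<and> y \<in> simplices X m \<and> \<not> degenerate X m y \<and> x = act X n m \<sigma> y"
    using assms
  proof (induction n arbitrary: x rule: less_induct)
    case (less n)
    show ?case
    proof (cases "degenerate X n x")
      case False
      then show ?thesis
        using less.prems act_id operators_id by metis
    next
      case True
      then obtain p \<alpha> z where p: "p < n" "\<alpha> \<in> operators n p" "z \<in> simplices X p" "x = act X n p \<alpha> z"
        by (auto simp: degenerate_def)
      obtain m \<sigma> y where y: "\<sigma> \<in> operators p m" "y \<in> simplices X m" "\<not> degenerate X m y"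
        "z = act X p m \<sigma> y"
        using less.IH[OF p(1,3)] by blast
      have "x = act X n m (compose {..n} \<sigma> \<alpha>) y"
        using p y by (simp add: act_comp)
      then show ?thesis
        using y p operators_compose by blast
    qed
  qed
  then show ?thesis using that by blast
qed

lemma vertex_of_act:
  assumes "\<alpha> \<in> operators m n" "x \<in> simplices X n" "i \<le> m"
  shows "act X 0 m (vertex_op i) (act X m n \<alpha> x) = act X 0 n (vertex_op (\<alpha> i)) x"
  using act_comp[OF vertex_op_in[OF assms(3)] assms(1,2)] by (simp add: compose_vertex_op)

end

context nonsingular_simplicial_set
begin

lemma vertices_eq_iff_collapse:
  assumes "x \<in> simplices X n"
  obtains m \<sigma> y where "\<sigma> \<in> operators n m" "y \<in> simplices X m" "x = act X n m \<sigma> y"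
    "\<And>i j. i \<le> n \<Longrightarrow> j \<le> n \<Longrightarrow>
      act X 0 n (vertex_op i) x = act X 0 n (vertex_op j) x \<longleftrightarrow> \<sigma> i = \<sigma> j"
proof -
  obtain m \<sigma> y where y: "\<sigma> \<in> operators n m" "y \<in> simplices X m" "\<not> degenerate X m y"
    "x = act X n m \<sigma> y"
    using nondegenerate_root[OF assms] .
  have inj: "inj_on (\<lambda>\<alpha>. act X 0 m \<alpha> y) (operators 0 m)"
    using nonsingular[OF y(2,3), of 0]
    by (simp add: representing_map_def standard_simplex_def inj_on_def)
  have "act X 0 n (vertex_op i) x = act X 0 n (vertex_op j) x \<longleftrightarrow> \<sigma> i = \<sigma> j"
    if "i \<le> n" "j \<le> n" for i j
    using inj_on_eq_iff[OF inj] that y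
    by (simp add: vertex_of_act vertex_op_in operators_le vertex_op_eq_iff)
  then show ?thesis using that y by blast
qed

lemma vertex_eq_between:
  assumes x: "x \<in> simplices X n" and ab: "a \<le> c" "c \<le> b" "b \<le> n"
    and "act X 0 n (vertex_op a) x = act X 0 n (vertex_op b) x"
  shows "act X 0 n (vertex_op a) x = act X 0 n (vertex_op c) x"
proof -
  obtain m \<sigma> y where "\<sigma> \<in> operators n m"
    and iff: "\<And>i j. i \<le> n \<Longrightarrow> j \<le> n \<Longrightarrow>
      act X 0 n (vertex_op i) x = act X 0 n (vertex_op j) x \<longleftrightarrow> \<sigma> i = \<sigma> j"
    using vertices_eq_iff_collapse[OF x] by metis
  moreover have "\<sigma> a = \<sigma> b"
    using iff assms by simp
  ultimately have "\<sigma> a = \<sigma> c"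
    using operators_mono[of \<sigma> n m a c] operators_mono[of \<sigma> n m c b] ab by simp
  then show ?thesis
    using iff assms by simp
qed

lemma faces_eq_if_vertices_eq:
  assumes x: "x \<in> simplices X n" and \<alpha>: "\<alpha> \<in> operators k n" and \<beta>: "\<beta> \<in> operators k n"
    and eq: "\<And>i. i \<le> k \<Longrightarrow> act X 0 n (vertex_op (\<alpha> i)) x = act X 0 n (vertex_op (\<beta> i)) x"
  shows "act X k n \<alpha> x = act X k n \<beta> x"
proof -
  obtain m \<sigma> y where y: "\<sigma> \<in> operators n m" "y \<in> simplices X m" "x = act X n m \<sigma> y"
    and iff: "\<And>i j. i \<le> n \<Longrightarrow> j \<le> n \<Longrightarrow>
      act X 0 n (vertex_op i) x = act X 0 n (vertex_op j) x \<longleftrightarrow> \<sigma> i = \<sigma> j"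
    using vertices_eq_iff_collapse[OF x] by metis
  have "compose {..k} \<sigma> \<alpha> = compose {..k} \<sigma> \<beta>"
    using iff eq operators_le[OF \<alpha>] operators_le[OF \<beta>] by (auto simp: compose_def fun_eq_iff)
  then show ?thesis
    using act_comp[OF \<alpha> y(1,2)] act_comp[OF \<beta> y(1,2)] y(3) by simp
qed

end

section \<open>Simplices of the mapping set\<close>

lemma mapping_sset_in:
  assumes "f \<in> simplices (mapping_sset X K) n" "\<gamma> \<in> operators k n" "y \<in> simplices K k"
  shows "f k (\<gamma>, y) \<in> simplices X k"
  using assms by (auto simp: mapping_sset_def simplicial_maps_def product_sset_def
      standard_simplex_def PiE_iff)

lemma mapping_sset_natural:
  assumes "f \<in> simplices (mapping_sset X K) n" "\<beta> \<in> operators j k" "\<gamma> \<in> operators k n"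
    "y \<in> simplices K k"
  shows "act X j k \<beta> (f k (\<gamma>, y)) = f j (compose {..j} \<gamma> \<beta>, act K j k \<beta> y)"
  using assms by (auto simp: mapping_sset_def simplicial_maps_def product_sset_def
      standard_simplex_def)

lemma mapping_sset_act_apply:
  assumes "\<gamma> \<in> operators k m" "y \<in> simplices K k"
  shows "act (mapping_sset X K) m n \<alpha> f k (\<gamma>, y) = f k (compose {..k} \<alpha> \<gamma>, y)"
  using assms by (simp add: mapping_sset_def product_sset_def standard_simplex_def compose_eq)

lemma mapping_sset_eqI:
  assumes f: "f \<in> simplices (mapping_sset X K) n" and g: "g \<in> simplices (mapping_sset X K) n"
    and eq: "\<And>k \<gamma> y. \<gamma> \<in> operators k n \<Longrightarrow> y \<in> simplices K k \<Longrightarrow> f k (\<gamma>, y) = g k (\<gamma>, y)"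
  shows "f = g"
proof
  fix k
  show "f k = g k"
  proof (rule extensionalityI)
    show "f k \<in> extensional (operators k n \<times> simplices K k)"
      "g k \<in> extensional (operators k n \<times> simplices K k)"
      using f g by (auto simp: mapping_sset_def simplicial_maps_def product_sset_def
          standard_simplex_def PiE_iff)
  qed (use eq in auto)
qed

text \<open>
  The prism between \<open>(\<alpha>, y)\<close> and \<open>(\<beta>, y)\<close> is cut into simplices that pass from \<open>\<alpha>\<close> to \<open>\<beta>\<close> at
  position \<open>j\<close>, for \<open>j \<le> k\<close>. Two consecutive faces of the \<open>j\<close>-th one follow \<open>\<alpha>\<close> on exactly the first
  \<open>j\<close>, respectively \<open>j + 1\<close>, positions, and they differ in a single vertex.
\<close>

lemma (in nonsingular_simplicial_set) prism_eq:
  fixes K :: "'b sset"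
  assumes K: "simplicial_set K" and f: "f \<in> simplices (mapping_sset X K) n"
    and \<alpha>: "\<alpha> \<in> operators k n" and \<beta>: "\<beta> \<in> operators k n"
    and le: "\<And>i. i \<le> k \<Longrightarrow> \<alpha> i \<le> \<beta> i"
    and y: "y \<in> simplices K k"
    and eq: "\<And>i v. i \<le> k \<Longrightarrow> v \<in> simplices K 0 \<Longrightarrow>
      f 0 (vertex_op (\<alpha> i), v) = f 0 (vertex_op (\<beta> i), v)"
  shows "f k (\<alpha>, y) = f k (\<beta>, y)"
proof -
  interpret K: simplicial_set K by fact
  define \<mu> where "\<mu> j = (\<lambda>i\<in>{..k}. if i < j then \<alpha> i else \<beta> i)" for j
  have step: "f k (\<mu> j, y) = f k (\<mu> (Suc j), y)" if j: "j \<le> k" for j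
  proof -
    \<comment> \<open>The prism simplex is \<open>(\<gamma>, s\<^sup>*y)\<close>; position \<open>j\<close> is doubled, as \<open>s\<close> takes the value \<open>j\<close> at
      \<open>j\<close> and \<open>j + 1\<close>, where \<open>\<gamma>\<close> is \<open>\<alpha> j\<close> and \<open>\<beta> j\<close>. The coface operator \<open>d l\<close> omits \<open>l\<close>.\<close>
    define \<gamma> where "\<gamma> = (\<lambda>i\<in>{..Suc k}. if i \<le> j then \<alpha> i else \<beta> (i - 1))"
    define s where "s = (\<lambda>i\<in>{..Suc k}. if i \<le> j then i else i - 1)"
    define d where "d l = (\<lambda>i\<in>{..k}. if i < l then i else Suc i)" for l :: nat
    have \<gamma>: "\<gamma> \<in> operators (Suc k) n"
      unfolding \<gamma>_def
    proof (rule restrict_in_operators)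
      show "(if i \<le> j then \<alpha> i else \<beta> (i - 1)) \<le> n" if "i \<le> Suc k" for i
        using that j operators_le[OF \<alpha>] operators_le[OF \<beta>] by auto
      show "(if i \<le> j then \<alpha> i else \<beta> (i - 1)) \<le> (if i' \<le> j then \<alpha> i' else \<beta> (i' - 1))"
        if "i \<le> i'" "i' \<le> Suc k" for i i'
      proof (cases "i \<le> j \<and> j < i'")
        case True
        have "\<alpha> i \<le> \<beta> i" "\<beta> i \<le> \<beta> (i' - 1)"
          using True that j le operators_mono[OF \<beta>, of i "i' - 1"] by auto
        then show ?thesis using True by simp
      next
        case False
        then show ?thesis
          using that j operators_mono[OF \<alpha>] operators_mono[OF \<beta>] by auto
      qed
    qed
    have s: "s \<in> operators (Suc k) k"
      unfolding s_def using j by (intro restrict_in_operators) auto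
    have d: "d l \<in> operators k (Suc k)" for l
      unfolding d_def by (intro restrict_in_operators) auto
    define x where "x = f (Suc k) (\<gamma>, act K (Suc k) k s y)"
    have sy: "act K (Suc k) k s y \<in> simplices K (Suc k)"
      using K.act_closed[OF s y] .
    have x: "x \<in> simplices X (Suc k)"
      unfolding x_def using f \<gamma> sy by (rule mapping_sset_in)
    have face: "act X k (Suc k) (d l) x = f k (\<mu> l, y)" if l: "l = j \<or> l = Suc j" for l
    proof -
      have "compose {..k} \<gamma> (d l) = \<mu> l"
        using l by (auto simp: compose_def \<gamma>_def d_def \<mu>_def fun_eq_iff)
      moreover have "compose {..k} s (d l) = restrict id {..k}"
        using l by (auto simp: compose_def s_def d_def fun_eq_iff)
      then have "act K k (Suc k) (d l) (act K (Suc k) k s y) = y"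
        using K.act_comp[OF d s y, of l] K.act_id[OF y] by simp
      ultimately show ?thesis
        unfolding x_def by (simp add: mapping_sset_natural[OF f d \<gamma> sy])
    qed
    have vertex: "act X 0 (Suc k) (vertex_op i) x =
        f 0 (vertex_op (\<gamma> i), act K 0 k (vertex_op (s i)) y)" if "i \<le> Suc k" for i
      unfolding x_def mapping_sset_natural[OF f vertex_op_in[OF that] \<gamma> sy]
      by (simp add: compose_vertex_op K.vertex_of_act[OF s y that])
    have "act X k (Suc k) (d j) x = act X k (Suc k) (d (Suc j)) x"
    proof (rule faces_eq_if_vertices_eq[OF x d d])
      fix i assume i: "i \<le> k"
      show "act X 0 (Suc k) (vertex_op (d j i)) x = act X 0 (Suc k) (vertex_op (d (Suc j) i)) x"
      proof (cases "i = j")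
        case True
        have "act K 0 k (vertex_op j) y \<in> simplices K 0"
          using K.act_closed[OF vertex_op_in[OF j] y] .
        then show ?thesis
          using True j eq[OF j] by (simp add: d_def vertex \<gamma>_def s_def)
      next
        case False
        then have "d j i = d (Suc j) i" by (auto simp: d_def)
        then show ?thesis by simp
      qed
    qed
    then show ?thesis by (simp add: face)
  qed
  have "f k (\<mu> 0, y) = f k (\<mu> j, y)" if "j \<le> Suc k" for j
    using that by (induction j) (auto simp: step)
  then have "f k (\<mu> 0, y) = f k (\<mu> (Suc k), y)" by simp
  moreover have "\<mu> 0 = \<beta>" "\<mu> (Suc k) = \<alpha>"
    using \<alpha> \<beta> by (auto simp: \<mu>_def fun_eq_iff operators_def PiE_iff extensional_def)
  ultimately show ?thesis by simp
qed

text \<open>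
  The vertices \<open>f (i, v)\<close>, for fixed \<open>v\<close>, are those of a single \<open>n\<close>-simplex of \<open>X\<close>: the value of \<open>f\<close>
  at the identity of \<open>[n]\<close> and the simplex of \<open>K\<close> that is constant at \<open>v\<close>.
\<close>

lemma (in nonsingular_simplicial_set) mapping_vertex_eq_between:
  fixes K :: "'b sset"
  assumes K: "simplicial_set K" and f: "f \<in> simplices (mapping_sset X K) n"
    and ab: "a \<le> c" "c \<le> b" "b \<le> n" and v: "v \<in> simplices K 0"
    and eq: "f 0 (vertex_op a, v) = f 0 (vertex_op b, v)"
  shows "f 0 (vertex_op a, v) = f 0 (vertex_op c, v)"
proof -
  interpret K: simplicial_set K by fact
  define z where "z = (\<lambda>i\<in>{..n}. 0::nat)"
  have z: "z \<in> operators n 0"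
    unfolding z_def by (rule restrict_in_operators) auto
  have z0: "z i = 0" if "i \<le> n" for i
    using that by (simp add: z_def)
  define x where "x = f n (restrict id {..n}, act K n 0 z v)"
  have zv: "act K n 0 z v \<in> simplices K n"
    using K.act_closed[OF z v] .
  have x: "x \<in> simplices X n"
    unfolding x_def by (rule mapping_sset_in[OF f operators_id zv])
  have "vertex_op 0 = restrict id {..0}"
    by (auto simp: vertex_op_def fun_eq_iff)
  then have "act K 0 0 (vertex_op 0) v = v"
    using K.act_id[OF v] by simp
  then have vertex: "act X 0 n (vertex_op i) x = f 0 (vertex_op i, v)" if "i \<le> n" for i
    unfolding x_def mapping_sset_natural[OF f vertex_op_in[OF that] operators_id zv]
    using that by (simp add: compose_vertex_op K.vertex_of_act[OF z v that] z0)
  show ?thesis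
    using vertex_eq_between[OF x ab] eq ab by (simp add: vertex)
qed

lemma (in nonsingular_simplicial_set) degenerate_if_vertices_eq:
  fixes K :: "'b sset"
  assumes K: "simplicial_set K" and f: "f \<in> simplices (mapping_sset X K) n"
    and ab: "a < b" "b \<le> n"
    and eq: "\<And>v. v \<in> simplices K 0 \<Longrightarrow> f 0 (vertex_op a, v) = f 0 (vertex_op b, v)"
  shows "degenerate (mapping_sset X K) n f"
proof -
  interpret M: simplicial_set "mapping_sset X K"
    using simplicial_set_mapping_sset[OF simplicial_set_axioms K] .
  \<comment> \<open>The operator \<open>d\<close> is a section of \<open>s\<close>, so \<open>f\<close> can only be \<open>s\<^sup>*g\<close> for \<open>g = d\<^sup>*f\<close>.\<close>
  define s where "s = (\<lambda>i\<in>{..n}. if i \<le> a then i else i - 1)"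
  define d where "d = (\<lambda>i\<in>{..n - 1}. if i \<le> a then i else Suc i)"
  have s: "s \<in> operators n (n - 1)"
    unfolding s_def using ab by (intro restrict_in_operators) auto
  have d: "d \<in> operators (n - 1) n"
    unfolding d_def using ab by (intro restrict_in_operators) auto
  have ds: "compose {..n} d s i = (if i = Suc a then a else i)" if "i \<le> n" for i
    using that ab by (auto simp: compose_def s_def d_def)
  have surj: "s ` {..n} = {..n - 1}"
  proof
    show "s ` {..n} \<subseteq> {..n - 1}"
      using operators_le[OF s] by auto
    show "{..n - 1} \<subseteq> s ` {..n}"
    proof
      fix i assume i: "i \<in> {..n - 1}"
      then have "s (d i) = i" "d i \<in> {..n}"
        using ab by (auto simp: s_def d_def)
      then show "i \<in> s ` {..n}" by force
    qed
  qed
  define g where "g = act (mapping_sset X K) (n - 1) n d f"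
  have g: "g \<in> simplices (mapping_sset X K) (n - 1)"
    unfolding g_def using M.act_closed[OF d f] .
  have sg: "act (mapping_sset X K) n (n - 1) s g =
      act (mapping_sset X K) n n (compose {..n} d s) f"
    unfolding g_def using M.act_comp[OF s d f] by simp
  have "f = act (mapping_sset X K) n (n - 1) s g"
  proof (rule mapping_sset_eqI[OF f M.act_closed[OF s g]])
    fix k \<gamma> y assume \<gamma>: "\<gamma> \<in> operators k n" and y: "y \<in> simplices K k"
    let ?\<alpha> = "compose {..k} (compose {..n} d s) \<gamma>"
    have val: "?\<alpha> i = (if \<gamma> i = Suc a then a else \<gamma> i)" if "i \<le> k" for i
      using that ds operators_le[OF \<gamma> that] by (simp add: compose_def)
    have "f k (?\<alpha>, y) = f k (\<gamma>, y)"
    proof (rule prism_eq[OF K f _ \<gamma> _ y])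
      show "?\<alpha> \<in> operators k n"
        using operators_compose[OF \<gamma> operators_compose[OF s d]] .
      show "?\<alpha> i \<le> \<gamma> i" if "i \<le> k" for i
        using val[OF that] by simp
      show "f 0 (vertex_op (?\<alpha> i), v) = f 0 (vertex_op (\<gamma> i), v)"
        if "i \<le> k" "v \<in> simplices K 0" for i v
        using val[OF that(1)] ab eq[OF that(2)]
          mapping_vertex_eq_between[OF K f _ _ ab(2) that(2), of a "Suc a"] by simp
    qed
    then show "f k (\<gamma>, y) = act (mapping_sset X K) n (n - 1) s g k (\<gamma>, y)"
      unfolding sg mapping_sset_act_apply[OF \<gamma> y] by simp
  qed
  moreover have "n - 1 < n" using ab by simp
  ultimately show ?thesis
    unfolding degenerate_def using s surj g by blast
qed

section \<open>Non-singularity of the mapping set\<close>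

theorem theorem1p1:
  fixes X :: "'a sset" and K :: "'b sset"
  assumes "simplicial_set X" and "simplicial_set K"
    and "nonsingular_simplicial_set X"
  shows "nonsingular_simplicial_set (mapping_sset X K)"
proof -
  interpret X: nonsingular_simplicial_set X by fact
  interpret M: simplicial_set "mapping_sset X K"
    using assms by (intro simplicial_set_mapping_sset)
  show ?thesis
  proof
    fix f n k
    assume f: "f \<in> simplices (mapping_sset X K) n"
      and nondeg: "\<not> degenerate (mapping_sset X K) n f"
    have "\<alpha> = \<beta>"
      if \<alpha>: "\<alpha> \<in> operators k n" and \<beta>: "\<beta> \<in> operators k n"
        and same: "act (mapping_sset X K) k n \<alpha> f = act (mapping_sset X K) k n \<beta> f" for \<alpha> \<beta>
    proof (rule operators_eqI[OF \<alpha> \<beta>])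
      fix i assume i: "i \<le> k"
      have "f 0 (vertex_op (\<alpha> i), v) = f 0 (vertex_op (\<beta> i), v)" if v: "v \<in> simplices K 0" for v
        using mapping_sset_act_apply[OF vertex_op_in[OF i] v, of X n \<alpha> f]
          mapping_sset_act_apply[OF vertex_op_in[OF i] v, of X n \<beta> f] same
        by (simp add: compose_vertex_op)
      then show "\<alpha> i = \<beta> i"
        using X.degenerate_if_vertices_eq[OF assms(2) f] nondeg operators_le[OF \<alpha> i]
          operators_le[OF \<beta> i]
        by (metis linorder_neqE_nat)
    qed
    then show "inj_on (representing_map (mapping_sset X K) n f k) (simplices (standard_simplex n) k)"
      by (auto simp: inj_on_def representing_map_def standard_simplex_def)
  qed
qed

end
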